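(* Let $p\in[1,\infty]$ and let $F:[\boldsymbol a,\boldsymbol b]\to\mathbb{R}$ with $\|F\|_{p,s,\boldsymbol\gamma}<\infty$. For $\emptyset\ne\mathfrak u\subseteq[s]$, $\boldsymbol j_{\mathfrak u}=(j_i)_{i\in\mathfrak u}\in\mathbb{N}_0^{|\mathfrak u|}$ and $(\boldsymbol m_{\mathfrak u},\boldsymbol 0)\in D_{(\boldsymbol j_{\mathfrak u},-\boldsymbol1)}$ we have $$\left|\widehat F^{(\boldsymbol\varphi)}((\boldsymbol j_{\mathfrak u},-\boldsymbol1),(\boldsymbol m_{\mathfrak u},\boldsymbol0))\right|\le\frac1{2^{|\boldsymbol j_{\mathfrak u}|/2}}\left(\prod_{i\in\mathfrak u}\lambda_{j_i,m_i}\right)\sup_{\boldsymbol x\in[\boldsymbol a,\boldsymbol b]}\left|\frac{\partial^{|\mathfrak u|}F}{\partial\boldsymbol x_{\mathfrak u}}(\boldsymbol x)\right|,$$ where $|\boldsymbol j_{\mathfrak u}|=\sum_{i\in\mathfrak u}j_i$ and $$\lambda_{j_i,m_i}=\frac12\left[\Phi_i^{-1}\left(\frac{m_i+1}{2^{j_i}}\right)-\Phi_i^{-1}\left(\frac{m_i}{2^{j_i}}\right)\right].$$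
   Context: Setting. Let $s\in\mathbb{N}$, $[s]=\{1,\ldots,s\}$, $-\infty<a_i<b_i<\infty$ for $i\in[s]$, $[\boldsymbol a,\boldsymbol b]=\prod_{i=1}^s[a_i,b_i]$. For each $i$ let $\varphi_i:[a_i,b_i]\to\mathbb{R}$ be a probability density function with respect to Lebesgue measure, $\varphi(\boldsymbol x)=\prod_{i=1}^s\varphi_i(x_i)$, $\boldsymbol\varphi=(\varphi_1,\ldots,\varphi_s)$, and let $\Phi_i(x)=\int_{a_i}^x\varphi_i(y)\,\mathrm{d}y$, which is assumed to be invertible as a map $[a_i,b_i]\to[0,1]$. Let $\boldsymbol\gamma=\{\gamma_{\mathfrak u}:\mathfrak u\subseteq[s]\}$ be positive real numbers (weights). Norm. For $\mathfrak u=\{u_1<\cdots<u_k\}\subseteq[s]$ let $\frac{\partial^{|\mathfrak u|}F}{\partial\boldsymbol x_{\mathfrak u}}=\frac{\partial^kF}{\partial x_{u_1}\cdots\partial x_{u_k}}$ (equal to $F$ for $\mathfrak u=\emptyset$). For functions $F:[\boldsymbol a,\boldsymbol b]\to\mathbb{R}$ for which these mixed partial derivatives exist, and $p\in[1,\infty]$, let $\|F\|_{p,s,\boldsymbol\gamma}=\left(\sum_{\mathfrak u\subseteq[s]}\left(\frac1{\gamma_{\mathfrak u}}\sup_{\boldsymbol x\in[\boldsymbol a,\boldsymbol b]}\left|\frac{\partial^{|\mathfrak u|}F}{\partial\boldsymbol x_{\mathfrak u}}(\boldsymbol x)\right|\right)^p\right)^{1/p}$, with the maximum over $\mathfrak u$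 if $p=\infty$. Haar functions. Let $\mathbb{N}_{-1}=\{-1,0,1,2,\ldots\}$, $D_{-1}=\{0\}$, $D_j=\{0,1,\ldots,2^j-1\}$ for $j\ge0$, and $D_{\boldsymbol j}=D_{j_1}\times\cdots\times D_{j_s}$ for $\boldsymbol j\in\mathbb{N}_{-1}^s$. The univariate Haar functions on $[0,1)$ are $h_{-1,0}=1$ and, for $j\ge0$, $m\in D_j$: $h_{j,m}(x)=2^{j/2}$ if $\frac m{2^j}\le x<\frac{2m+1}{2^{j+1}}$, $h_{j,m}(x)=-2^{j/2}$ if $\frac{2m+1}{2^{j+1}}\le x<\frac{m+1}{2^j}$, and $h_{j,m}(x)=0$ otherwise. Put $h^{(\boldsymbol\varphi)}_{\boldsymbol j,\boldsymbol m}(\boldsymbol x)=\prod_{i=1}^sh_{j_i,m_i}(\Phi_i(x_i))$ for $\boldsymbol j\in\mathbb{N}_{-1}^s$, $\boldsymbol m\in D_{\boldsymbol j}$, and $\widehat F^{(\boldsymbol\varphi)}(\boldsymbol j,\boldsymbol m)=\int_{[\boldsymbol a,\boldsymbol b]}F(\boldsymbol x)h^{(\boldsymbol\varphi)}_{\boldsymbol j,\boldsymbol m}(\boldsymbol x)\varphi(\boldsymbol x)\,\mathrm d\boldsymbol x$. Notation. $(\boldsymbol j_{\mathfrak u},-\boldsymbol1)\in\mathbb{N}_{-1}^s$ is the vector whose $i$-th component is $j_i$ if $i\in\mathfrak u$ and $-1$ otherwise; $(\boldsymbol m_{\mathfrak u},\boldsymbol0)$ is the vector whose $i$-th component is $m_i$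 if $i\in\mathfrak u$ and $0$ otherwise. *)

theory Defs
  imports "HOL-Analysis.Analysis"
begin

text \<open>
  The index set \<open>[s]\<close> is a finite, linearly ordered type \<open>'n\<close> (so \<open>s = CARD('n)\<close>), points are
  of type \<open>real ^ 'n\<close>, and \<open>[a, b]\<close> is \<open>cbox a b\<close>. Functions on \<open>[a, b]\<close> (and
  families indexed by a subset of \<open>[s]\<close>) are total; the definitions below never depend on
  values outside the intended domain.
\<close>

subsection \<open>Mixed partial derivatives on a box\<close>

definition vec_upd :: "real ^ 'n \<Rightarrow> 'n \<Rightarrow> real \<Rightarrow> real ^ 'n" where
  "vec_upd x i t = (\<chi> k. if k = i then t else x $ k)"

text \<open>Derivatives are taken within \<open>[a\<^sub>i, b\<^sub>i]\<close>, hence one-sided on the boundary of the box.\<close>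

definition partial_deriv ::
    "real ^ 'n \<Rightarrow> real ^ 'n \<Rightarrow> 'n \<Rightarrow> (real ^ 'n \<Rightarrow> real) \<Rightarrow> real ^ 'n \<Rightarrow> real" where
  "partial_deriv a b i F x =
     vector_derivative (\<lambda>t. F (vec_upd x i t)) (at (x $ i) within {a $ i..b $ i})"

definition has_partial_deriv_on ::
    "real ^ 'n \<Rightarrow> real ^ 'n \<Rightarrow> 'n \<Rightarrow> (real ^ 'n \<Rightarrow> real) \<Rightarrow> bool" where
  "has_partial_deriv_on a b i F \<longleftrightarrow>
     (\<forall>x\<in>cbox a b. (\<lambda>t. F (vec_upd x i t)) differentiable (at (x $ i) within {a $ i..b $ i}))"

text \<open>For a list \<open>[u\<^sub>1, \<dots>, u\<^sub>k]\<close> the derivative with respect to \<open>u\<^sub>k\<close> is taken first, following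
  \<open>\<partial>\<^sup>kF / \<partial>x\<^bsub>u\<^sub>1\<^esub> \<cdots> \<partial>x\<^bsub>u\<^sub>k\<^esub> = \<partial>/\<partial>x\<^bsub>u\<^sub>1\<^esub> (\<cdots> (\<partial>F/\<partial>x\<^bsub>u\<^sub>k\<^esub>))\<close>.\<close>

definition iter_partial ::
    "real ^ 'n \<Rightarrow> real ^ 'n \<Rightarrow> 'n list \<Rightarrow> (real ^ 'n \<Rightarrow> real) \<Rightarrow> real ^ 'n \<Rightarrow> real" where
  "iter_partial a b is F = foldr (partial_deriv a b) is F"

fun has_iter_partial ::
    "real ^ 'n \<Rightarrow> real ^ 'n \<Rightarrow> 'n list \<Rightarrow> (real ^ 'n \<Rightarrow> real) \<Rightarrow> bool" where
  "has_iter_partial a b [] F \<longleftrightarrow> True"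
| "has_iter_partial a b (i # is) F \<longleftrightarrow>
     has_iter_partial a b is F \<and> has_partial_deriv_on a b i (iter_partial a b is F)"

definition mixed_partial ::
    "real ^ 'n::{finite,linorder} \<Rightarrow> real ^ 'n::_ \<Rightarrow> 'n set \<Rightarrow> (real ^ 'n::_ \<Rightarrow> real) \<Rightarrow> real ^ 'n::_ \<Rightarrow> real" where
  "mixed_partial a b u F = iter_partial a b (sorted_list_of_set u) F"

definition has_mixed_partials ::
    "real ^ 'n::{finite,linorder} \<Rightarrow> real ^ 'n::_ \<Rightarrow> (real ^ 'n::_ \<Rightarrow> real) \<Rightarrow> bool" where
  "has_mixed_partials a b F \<longleftrightarrow> (\<forall>u. has_iter_partial a b (sorted_list_of_set u) F)"

subsection \<open>The weighted norm\<close>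

text \<open>Only used with a positive real exponent.\<close>

definition ennreal_powr :: "ennreal \<Rightarrow> real \<Rightarrow> ennreal" where
  "ennreal_powr x r = (if x = \<infinity> then \<infinity> else ennreal (enn2real x powr r))"

definition weighted_sup ::
    "real ^ 'n::{finite,linorder} \<Rightarrow> real ^ 'n::_ \<Rightarrow> ('n set \<Rightarrow> real) \<Rightarrow> (real ^ 'n::_ \<Rightarrow> real) \<Rightarrow> 'n set \<Rightarrow> ennreal" where
  "weighted_sup a b \<gamma> F u =
     ennreal (1 / \<gamma> u) * (SUP x\<in>cbox a b. ennreal \<bar>mixed_partial a b u F x\<bar>)"

definition weighted_norm ::
    "real ^ 'n::{finite,linorder} \<Rightarrow> real ^ 'n::_ \<Rightarrow> ennreal \<Rightarrow> ('n set \<Rightarrow> real) \<Rightarrow> (real ^ 'n::_ \<Rightarrow> real) \<Rightarrow> ennreal" where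
  "weighted_norm a b p \<gamma> F =
     (if p = \<infinity> then (MAX u\<in>UNIV. weighted_sup a b \<gamma> F u)
      else ennreal_powr (\<Sum>u\<in>UNIV. ennreal_powr (weighted_sup a b \<gamma> F u) (enn2real p))
             (1 / enn2real p))"

subsection \<open>Densities and distribution functions\<close>

definition prob_density_on :: "real \<Rightarrow> real \<Rightarrow> (real \<Rightarrow> real) \<Rightarrow> bool" where
  "prob_density_on c d f \<longleftrightarrow>
     (\<forall>x\<in>{c..d}. 0 \<le> f x) \<and> has_bochner_integral (lebesgue_on {c..d}) f 1"

definition cdf_on :: "real \<Rightarrow> (real \<Rightarrow> real) \<Rightarrow> real \<Rightarrow> real" where
  "cdf_on c f x = (LINT y|lebesgue_on {c..x}. f y)"

definition inv_cdf_on :: "real \<Rightarrow> real \<Rightarrow> (real \<Rightarrow> real) \<Rightarrow> real \<Rightarrow> real" where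
  "inv_cdf_on c d f = the_inv_into {c..d} (cdf_on c f)"

subsection \<open>Haar functions and Haar coefficients\<close>

definition haar_D :: "int \<Rightarrow> nat set" where
  "haar_D j = (if j = -1 then {0} else {0..<2 ^ nat j})"

text \<open>The level \<open>j\<close> ranges over \<open>{-1..}\<close>. For \<open>j = -1\<close> the function is also set to \<open>1\<close> outside
  \<open>[0, 1)\<close>; below this matters only at the single point where the distribution function
  equals \<open>1\<close>, a null set.\<close>

definition haar :: "int \<Rightarrow> nat \<Rightarrow> real \<Rightarrow> real" where
  "haar j m x =
     (if j = -1 then 1
      else if real m / 2 ^ nat j \<le> x \<and> x < (2 * real m + 1) / 2 ^ (nat j + 1)
        then 2 powr (real_of_int j / 2)
      else if (2 * real m + 1) / 2 ^ (nat j + 1) \<le> x \<and> x < (real m + 1) / 2 ^ nat j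
        then - (2 powr (real_of_int j / 2))
      else 0)"

definition haar_prod ::
    "real ^ 'n \<Rightarrow> ('n::finite \<Rightarrow> real \<Rightarrow> real) \<Rightarrow> ('n \<Rightarrow> int) \<Rightarrow> ('n \<Rightarrow> nat) \<Rightarrow> real ^ 'n \<Rightarrow> real" where
  "haar_prod a \<phi> j m x = (\<Prod>i\<in>UNIV. haar (j i) (m i) (cdf_on (a $ i) (\<phi> i) (x $ i)))"

definition haar_coeff ::
    "real ^ 'n \<Rightarrow> real ^ 'n \<Rightarrow> ('n::finite \<Rightarrow> real \<Rightarrow> real) \<Rightarrow> (real ^ 'n \<Rightarrow> real) \<Rightarrow>
     ('n \<Rightarrow> int) \<Rightarrow> ('n \<Rightarrow> nat) \<Rightarrow> real" where
  "haar_coeff a b \<phi> F j m =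
     (LINT x|lebesgue_on (cbox a b). F x * haar_prod a \<phi> j m x * (\<Prod>i\<in>UNIV. \<phi> i (x $ i)))"

definition haar_lambda :: "real \<Rightarrow> real \<Rightarrow> (real \<Rightarrow> real) \<Rightarrow> nat \<Rightarrow> nat \<Rightarrow> real" where
  "haar_lambda c d f j m =
     1 / 2 * (inv_cdf_on c d f ((real m + 1) / 2 ^ j) - inv_cdf_on c d f (real m / 2 ^ j))"

text \<open>\<open>(j\<^sub>u, -1)\<close> and \<open>(m\<^sub>u, 0)\<close>\<close>

definition ext_level :: "'n set \<Rightarrow> ('n \<Rightarrow> nat) \<Rightarrow> 'n \<Rightarrow> int" where
  "ext_level u j = (\<lambda>i. if i \<in> u then int (j i) else -1)"

definition ext_shift :: "'n set \<Rightarrow> ('n \<Rightarrow> nat) \<Rightarrow> 'n \<Rightarrow> nat" where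
  "ext_shift u m = (\<lambda>i. if i \<in> u then m i else 0)"

end

theory Submission
  imports Defs
begin

text \<open>
  The coefficient is the integral of \<open>F\<close> against a product of univariate weights
  \<open>w i = h (\<Phi> i) \<cdot> \<phi> i\<close>. For \<open>i \<in> u\<close> the weight has integral \<open>0\<close>, its absolute
  value has integral \<open>2 powr - (j i / 2)\<close>, and it vanishes outside an interval of length
  \<open>2 \<lambda>\<close>, with midpoint \<open>d i\<close> say. By Fubini, \<open>F\<close> may therefore be replaced by its mixed
  difference with respect to the coordinates in \<open>u\<close> between \<open>x\<close> and \<open>d\<close>. Taking the
  difference in the innermost differentiated variable last, the mean value theorem bounds
  this mixed difference by \<open>sup \<bar>\<partial>\<^sub>u F\<bar>\<close> times the product of the \<open>\<bar>x i - d i\<bar> \<le> \<lambda>\<close>,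
  without any continuity of the mixed derivative. That \<open>F\<close> itself is continuous, hence
  integrable against the weights, follows from the bounds on the first order derivatives.
\<close>

subsection \<open>Lebesgue measure on vectors as a product measure\<close>

lemma vec_upd_nth [simp]: "vec_upd x i t $ k = (if k = i then t else x $ k)"
  by (simp add: vec_upd_def)

lemma vec_upd_same [simp]: "vec_upd x i (x $ i) = x"
  by (simp add: vec_eq_iff)

lemma vec_upd_twist: "i \<noteq> k \<Longrightarrow> vec_upd (vec_upd x i s) k t = vec_upd (vec_upd x k t) i s"
  by (auto simp: vec_eq_iff)

lemma vec_upd_in_cbox:
  "x \<in> cbox a b \<Longrightarrow> t \<in> {a $ i..b $ i} \<Longrightarrow> vec_upd x i t \<in> cbox a b"
  by (auto simp: mem_box_cart)

lemma continuous_on_vec_upd: "continuous_on S (\<lambda>x. vec_upd x i t)"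
proof -
  have "continuous_on S (\<lambda>x. if k = i then t else x $ k)" for k
    by (cases "k = i") (auto intro!: continuous_intros)
  then show ?thesis
    unfolding vec_upd_def by (intro continuous_on_vec_lambda)
qed

lemma measurable_vec_lambda:
  "(\<lambda>f. (\<chi> i. f i) :: real ^ 'n) \<in> (\<Pi>\<^sub>M i\<in>UNIV. lborel) \<rightarrow>\<^sub>M borel"
  by (subst borel_measurable_euclidean_space) (auto simp: Basis_vec_def inner_axis)

lemma borel_measurable_vec_nth: "(\<lambda>x :: real ^ 'n. x $ i) \<in> borel_measurable borel"
  by (intro borel_measurable_continuous_onI continuous_intros)

text \<open>Lebesgue measure is determined by its values on open boxes, and the preimage of a box
  under \<open>\<lambda>f. \<chi> i. f i\<close> is a product of open intervals. This makes Fubini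
  for finite products available on \<open>real ^ 'n\<close>.\<close>

lemma lborel_vec_eq_PiM:
  "(lborel :: (real ^ 'n) measure) = distr (\<Pi>\<^sub>M i\<in>UNIV. lborel) borel (\<lambda>f. \<chi> i. f i)"
proof (rule lborel_eqI)
  interpret product_sigma_finite "\<lambda>i::'n. lborel :: real measure"
    by standard
  fix l u :: "real ^ 'n"
  assume le: "\<And>b. b \<in> Basis \<Longrightarrow> l \<bullet> b \<le> u \<bullet> b"
  have le': "l $ i \<le> u $ i" for i
    using le[of "axis i 1"] by (simp add: axis_in_Basis_iff cart_eq_inner_axis)
  have "(\<lambda>f. (\<chi> i. f i) :: real ^ 'n) -` box l u \<inter> space (\<Pi>\<^sub>M i\<in>UNIV. lborel)
      = (\<Pi>\<^sub>E i\<in>UNIV. {l $ i<..<u $ i})"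
    by (auto simp: mem_box_cart space_PiM PiE_iff)
  moreover have "emeasure (\<Pi>\<^sub>M i\<in>UNIV. lborel) (\<Pi>\<^sub>E i\<in>UNIV. {l $ i<..<u $ i})
      = (\<Prod>i\<in>UNIV. ennreal (u $ i - l $ i))"
    by (subst emeasure_PiM) (auto simp: le')
  moreover have "(\<Prod>b\<in>Basis. (u - l) \<bullet> b) = (\<Prod>i\<in>UNIV. u $ i - l $ i)"
    by (subst prod.reindex_bij_betw[of "\<lambda>i. axis i 1" UNIV Basis, symmetric])
       (auto simp: bij_betw_def inj_on_def axis_eq_axis Basis_vec_def inner_axis)
  ultimately show "emeasure (distr (\<Pi>\<^sub>M i\<in>UNIV. lborel) borel (\<lambda>f. \<chi> i. f i)) (box l u)
      = (\<Prod>b\<in>Basis. (u - l) \<bullet> b)"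
    by (simp add: emeasure_distr prod_ennreal le' measurable_vec_lambda)
qed simp

text \<open>The cylinder over a null set is a product set with one factor of measure zero. This lets
  the univariate weights be changed on null sets inside a multivariate integral.\<close>

lemma AE_lborel_vec_nth:
  fixes P :: "real \<Rightarrow> bool"
  assumes "AE t in lborel. P t"
  shows "AE x in (lborel :: (real ^ 'n) measure). P (x $ i)"
proof -
  interpret product_sigma_finite "\<lambda>i::'n. lborel :: real measure"
    by standard
  obtain N where "{t \<in> space lborel. \<not> P t} \<subseteq> N" "emeasure lborel N = 0" "N \<in> sets lborel"
    by (rule AE_E[OF assms])
  then have N: "N \<in> null_sets lborel" "{t. \<not> P t} \<subseteq> N"
    by auto
  let ?A = "{x :: real ^ 'n. x $ i \<in> N}"
  have A: "?A \<in> sets borel"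
    using measurable_sets[OF borel_measurable_vec_nth, of N i] N by (auto simp: vimage_def)
  have "(\<lambda>f. \<chi> i. f i) -` ?A \<inter> space (\<Pi>\<^sub>M i\<in>UNIV. lborel)
      = (\<Pi>\<^sub>E k\<in>UNIV. if k = i then N else UNIV)"
    by (auto simp: space_PiM PiE_iff split: if_splits)
  moreover have "emeasure (\<Pi>\<^sub>M k\<in>UNIV. lborel) (\<Pi>\<^sub>E k\<in>UNIV. if k = i then N else UNIV)
      = (\<Prod>k\<in>UNIV. emeasure lborel (if k = i then N else UNIV))"
    using N by (subst emeasure_PiM) auto
  \<comment> \<open>The remaining factors may be infinite, but zero times infinity is zero in
    \<open>ennreal\<close>.\<close>
  moreover have "\<dots> = 0"
    using N by (intro prod_zero) auto
  ultimately have "emeasure lborel ?A = 0"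
    using A by (simp add: lborel_vec_eq_PiM emeasure_distr measurable_vec_lambda)
  with A have "?A \<in> null_sets lborel"
    by auto
  then show ?thesis
    using N by (intro AE_I'[of ?A]) auto
qed

lemma
  fixes w :: "'n::finite \<Rightarrow> real \<Rightarrow> real"
  assumes w: "\<And>i. integrable lborel (w i)"
  shows integrable_lborel_vec_prod: "integrable lborel (\<lambda>x :: real ^ 'n. \<Prod>i\<in>UNIV. w i (x $ i))"
    and integral_lborel_vec_prod:
      "(LINT x|lborel. (\<Prod>i\<in>UNIV. w i ((x :: real ^ 'n) $ i))) = (\<Prod>i\<in>UNIV. (LINT t|lborel. w i t))"
proof -
  interpret product_sigma_finite "\<lambda>i::'n. lborel :: real measure"
    by standard
  have "(\<lambda>x :: real ^ 'n. w i (x $ i)) \<in> borel_measurable borel" for i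
    using w by (intro measurable_compose[OF borel_measurable_vec_nth]) auto
  then have m: "(\<lambda>x :: real ^ 'n. \<Prod>i\<in>UNIV. w i (x $ i)) \<in> borel_measurable borel"
    by auto
  show "integrable lborel (\<lambda>x :: real ^ 'n. \<Prod>i\<in>UNIV. w i (x $ i))"
    unfolding lborel_vec_eq_PiM using product_integrable_prod[of UNIV w] w m
    by (simp add: integrable_distr_eq measurable_vec_lambda)
  show "(LINT x|lborel. (\<Prod>i\<in>UNIV. w i ((x :: real ^ 'n) $ i))) = (\<Prod>i\<in>UNIV. (LINT t|lborel. w i t))"
    unfolding lborel_vec_eq_PiM using product_integral_prod[of UNIV w] w m
    by (simp add: integral_distr measurable_vec_lambda)
qed

text \<open>Since \<open>G (vec_upd x i d)\<close> does not depend on \<open>x $ i\<close>,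
  integrating over this coordinate first meets only the factor \<open>w i\<close>, whose integral is
  zero.\<close>

lemma integral_lborel_vec_prod_eq_0:
  fixes w :: "'n::finite \<Rightarrow> real \<Rightarrow> real" and G :: "real ^ 'n \<Rightarrow> real"
  assumes int: "integrable lborel (\<lambda>x. G (vec_upd x i d) * (\<Prod>k\<in>UNIV. w k (x $ k)))"
    and "(LINT t|lborel. w i t) = 0"
  shows "(LINT x|lborel. G (vec_upd x i d) * (\<Prod>k\<in>UNIV. w k (x $ k))) = 0"
proof -
  interpret product_sigma_finite "\<lambda>i::'n. lborel :: real measure"
    by standard
  let ?g = "\<lambda>f. G (vec_upd (\<chi> k. f k) i d) * (\<Prod>k\<in>UNIV. w k (f k))"
  have U: "insert i (UNIV - {i}) = UNIV"
    by auto
  have m: "(\<lambda>x. G (vec_upd x i d) * (\<Prod>k\<in>UNIV. w k (x $ k))) \<in> borel_measurable borel"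
    using int by auto
  have inner: "(LINT t|lborel. ?g (f(i := t))) = 0" for f
  proof -
    have "?g (f(i := t)) = G (vec_upd (\<chi> k. f k) i d) * (\<Prod>k\<in>UNIV - {i}. w k (f k)) * w i t" for t
    proof -
      have "vec_upd (\<chi> k. (f(i := t)) k) i d = vec_upd (\<chi> k. f k) i d"
        by (simp add: vec_eq_iff)
      then show ?thesis
        by (simp add: prod.remove[of UNIV i])
    qed
    then show ?thesis
      using assms(2) by simp
  qed
  have "integrable (\<Pi>\<^sub>M k\<in>insert i (UNIV - {i}). lborel) ?g"
    using int m unfolding lborel_vec_eq_PiM U
    by (simp add: integrable_distr_eq measurable_vec_lambda)
  from product_integral_insert[OF _ _ this]
  have "(LINT f|(\<Pi>\<^sub>M k\<in>UNIV. lborel). ?g f)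
      = (LINT f|(\<Pi>\<^sub>M k\<in>UNIV - {i}. lborel). LINT t|lborel. ?g (f(i := t)))"
    unfolding U by simp
  also have "\<dots> = 0"
    by (simp only: inner Bochner_Integration.integral_zero)
  finally show ?thesis
    using m unfolding lborel_vec_eq_PiM
    by (simp add: integral_distr measurable_vec_lambda)
qed

lemma integrable_continuous_on_cbox_prod:
  fixes w :: "'n::finite \<Rightarrow> real \<Rightarrow> real" and G :: "real ^ 'n \<Rightarrow> real"
  assumes G: "continuous_on (cbox a b) G"
    and w: "\<And>i. integrable lborel (w i)" "\<And>i t. t \<notin> {a $ i..b $ i} \<Longrightarrow> w i t = 0"
  shows "integrable lborel (\<lambda>x. G x * (\<Prod>i\<in>UNIV. w i (x $ i)))"
proof -
  obtain C where C: "\<And>x. x \<in> cbox a b \<Longrightarrow> \<bar>G x\<bar> \<le> C"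
    using compact_imp_bounded[OF compact_continuous_image[OF G compact_cbox]]
    by (auto simp: bounded_iff)
  \<comment> \<open>Nothing is known about \<open>G\<close> outside the box, where it may fail to be
    measurable. The weights vanish there, so \<open>G\<close> can be cut off without changing the
    product.\<close>
  have eq: "G x * (\<Prod>i\<in>UNIV. w i (x $ i))
      = indicator (cbox a b) x *\<^sub>R G x * (\<Prod>i\<in>UNIV. w i (x $ i))" for x
    using w(2) by (cases "x \<in> cbox a b") (auto simp: mem_box_cart intro!: prod_zero)
  have m: "(\<lambda>x. indicator (cbox a b) x *\<^sub>R G x) \<in> borel_measurable borel"
    using G by (intro borel_measurable_continuous_on_indicator) auto
  note P = integrable_lborel_vec_prod[of w, OF w(1)]
  show ?thesis
    unfolding eq
  proof (rule Bochner_Integration.integrable_bound)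
    show "integrable lborel (\<lambda>x. C * (\<Prod>i\<in>UNIV. w i (x $ i)))"
      using P by simp
    show "(\<lambda>x. indicator (cbox a b) x *\<^sub>R G x * (\<Prod>i\<in>UNIV. w i (x $ i))) \<in> borel_measurable lborel"
      using m P by (intro borel_measurable_times) auto
    have "norm (indicator (cbox a b) x *\<^sub>R G x * (\<Prod>i\<in>UNIV. w i (x $ i)))
        \<le> norm (C * (\<Prod>i\<in>UNIV. w i (x $ i)))" for x
      using C[of x] by (auto simp: indicator_def abs_mult intro!: mult_right_mono)
    then show "AE x in lborel. norm (indicator (cbox a b) x *\<^sub>R G x * (\<Prod>i\<in>UNIV. w i (x $ i)))
        \<le> norm (C * (\<Prod>i\<in>UNIV. w i (x $ i)))"
      by simp
  qed
qed

subsection \<open>Mixed differences against a fixed point\<close>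

text \<open>For distinct indices, \<open>fold (diff_at d) is G x\<close> is the alternating sum of
  \<open>G\<close> over the points obtained from \<open>x\<close> by replacing some of the
  coordinates in \<open>is\<close> by those of \<open>d\<close>.\<close>

definition diff_at :: "real ^ 'n \<Rightarrow> 'n \<Rightarrow> (real ^ 'n \<Rightarrow> real) \<Rightarrow> real ^ 'n \<Rightarrow> real" where
  "diff_at d i G x = G x - G (vec_upd x i (d $ i))"

text \<open>The last entry of the list is the variable differentiated first. Under
  \<open>fold\<close> it is also the variable in which the difference is taken last, so the
  induction below peels lists from the right.\<close>

lemma has_iter_partial_snoc:
  "has_iter_partial a b (is @ [i]) F \<longleftrightarrow>
    has_partial_deriv_on a b i F \<and> has_iter_partial a b is (partial_deriv a b i F)"
  by (induction "is") (auto simp: iter_partial_def)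

lemma iter_partial_snoc:
  "iter_partial a b (is @ [i]) F = iter_partial a b is (partial_deriv a b i F)"
  by (simp add: iter_partial_def)

lemma continuous_on_diff_at:
  assumes "continuous_on (cbox a b) G" "d \<in> cbox a b"
  shows "continuous_on (cbox a b) (diff_at d i G)"
proof -
  have "continuous_on (cbox a b) (\<lambda>x. G (vec_upd x i (d $ i)))"
    using assms by (intro continuous_on_compose2[OF assms(1) continuous_on_vec_upd])
      (auto intro!: vec_upd_in_cbox simp: mem_box_cart)
  then show ?thesis
    unfolding diff_at_def using assms(1) by (intro continuous_intros)
qed

lemma continuous_on_fold_diff_at:
  assumes "continuous_on (cbox a b) G" "d \<in> cbox a b"
  shows "continuous_on (cbox a b) (fold (diff_at d) is G)"
  using assms by (induction "is" arbitrary: G) (auto intro: continuous_on_diff_at)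

text \<open>The term subtracted by each difference is constant in the coordinate concerned, so it
  integrates to zero against a weight of mean zero in that coordinate.\<close>

lemma integral_fold_diff_at:
  fixes w :: "'n::finite \<Rightarrow> real \<Rightarrow> real"
  assumes w: "\<And>i. integrable lborel (w i)" "\<And>i t. t \<notin> {a $ i..b $ i} \<Longrightarrow> w i t = 0"
    and d: "d \<in> cbox a b"
    and "continuous_on (cbox a b) G"
    and "\<And>i. i \<in> set is \<Longrightarrow> (LINT t|lborel. w i t) = 0"
  shows "(LINT x|lborel. fold (diff_at d) is G x * (\<Prod>i\<in>UNIV. w i (x $ i)))
    = (LINT x|lborel. G x * (\<Prod>i\<in>UNIV. w i (x $ i)))"
  using assms(4,5)
proof (induction "is" arbitrary: G)
  case (Cons i "is")
  have c: "continuous_on (cbox a b) (\<lambda>x. G (vec_upd x i (d $ i)))"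
    using d by (intro continuous_on_compose2[OF Cons.prems(1) continuous_on_vec_upd])
      (auto intro!: vec_upd_in_cbox simp: mem_box_cart)
  note i0 = integrable_continuous_on_cbox_prod[OF Cons.prems(1) w]
  note i1 = integrable_continuous_on_cbox_prod[OF c w]
  have "(LINT x|lborel. fold (diff_at d) is (diff_at d i G) x * (\<Prod>i\<in>UNIV. w i (x $ i)))
      = (LINT x|lborel. diff_at d i G x * (\<Prod>i\<in>UNIV. w i (x $ i)))"
    using Cons.prems by (intro Cons.IH continuous_on_diff_at d) auto
  also have "\<dots> = (LINT x|lborel. G x * (\<Prod>i\<in>UNIV. w i (x $ i)))
      - (LINT x|lborel. G (vec_upd x i (d $ i)) * (\<Prod>i\<in>UNIV. w i (x $ i)))"
    unfolding diff_at_def left_diff_distrib by (intro Bochner_Integration.integral_diff i0 i1)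
  also have "(LINT x|lborel. G (vec_upd x i (d $ i)) * (\<Prod>i\<in>UNIV. w i (x $ i))) = 0"
    using Cons.prems by (intro integral_lborel_vec_prod_eq_0 i1) auto
  finally show ?case
    by simp
qed simp

lemma has_partial_deriv_on_imp_DERIV:
  assumes "has_partial_deriv_on a b i F" "x \<in> cbox a b"
  shows "((\<lambda>t. F (vec_upd x i t)) has_real_derivative partial_deriv a b i F x)
    (at (x $ i) within {a $ i..b $ i})"
  using assms unfolding has_partial_deriv_on_def partial_deriv_def
    has_real_derivative_iff_has_vector_derivative
  by (intro vector_derivative_works[THEN iffD1]) blast

lemma fold_diff_at_has_real_derivative:
  assumes F: "has_partial_deriv_on a b i F" and d: "d \<in> cbox a b"
    and "i \<notin> set is" "x \<in> cbox a b"
  shows "((\<lambda>t. fold (diff_at d) is F (vec_upd x i t)) has_real_derivative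
      fold (diff_at d) is (partial_deriv a b i F) x) (at (x $ i) within {a $ i..b $ i})"
  using assms(3,4)
proof (induction "is" arbitrary: x rule: rev_induct)
  case Nil
  then show ?case
    using has_partial_deriv_on_imp_DERIV[OF F] by simp
next
  case (snoc k "is")
  let ?y = "vec_upd x k (d $ k)"
  have y: "?y \<in> cbox a b"
    using snoc.prems d by (intro vec_upd_in_cbox) (auto simp: mem_box_cart)
  \<comment> \<open>As \<open>k \<noteq> i\<close>, the subtracted term also runs along a line in
    direction \<open>i\<close>, now through \<open>?y\<close>, and \<open>?y $ i = x $ i\<close>.
    The induction hypothesis thus applies to both terms.\<close>
  have tw: "vec_upd (vec_upd x i t) k (d $ k) = vec_upd ?y i t" for t
    using snoc.prems by (intro vec_upd_twist) auto
  have "((\<lambda>t. fold (diff_at d) is F (vec_upd ?y i t)) has_real_derivative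
      fold (diff_at d) is (partial_deriv a b i F) ?y) (at (x $ i) within {a $ i..b $ i})"
    using snoc.IH[OF _ y] snoc.prems by (simp split: if_splits)
  then show ?case
    using snoc.IH[of x] snoc.prems
    by (auto simp: diff_at_def[of d k] tw intro!: DERIV_diff)
qed

text \<open>With \<open>i\<close> the last entry, the outermost difference is an increment along
  direction \<open>i\<close>. The derivative along this segment is a mixed difference of
  \<open>partial_deriv a b i F\<close> in the other variables, which the induction hypothesis
  bounds; the mean value inequality supplies the factor for \<open>i\<close>.\<close>

lemma abs_fold_diff_at_le:
  assumes "distinct is" "has_iter_partial a b is F" "d \<in> cbox a b" "x \<in> cbox a b"
    and "\<And>y. y \<in> cbox a b \<Longrightarrow> \<bar>iter_partial a b is F y\<bar> \<le> M"
  shows "\<bar>fold (diff_at d) is F x\<bar> \<le> M * (\<Prod>i\<in>set is. \<bar>x $ i - d $ i\<bar>)"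
  using assms(1,2,4,5)
proof (induction "is" arbitrary: F x rule: rev_induct)
  case Nil
  then show ?case
    by (simp add: iter_partial_def)
next
  case (snoc i "is")
  let ?D = "fold (diff_at d) is"
  let ?C = "M * (\<Prod>k\<in>set is. \<bar>x $ k - d $ k\<bar>)"
  have F: "has_partial_deriv_on a b i F" and F': "has_iter_partial a b is (partial_deriv a b i F)"
    and i: "i \<notin> set is"
    using snoc.prems by (auto simp: has_iter_partial_snoc)
  have in_box: "vec_upd x i t \<in> cbox a b" if "t \<in> {a $ i..b $ i}" for t
    using vec_upd_in_cbox[OF snoc.prems(3) that] .
  have upd2: "vec_upd (vec_upd x i t) i s = vec_upd x i s" for s t
    by (simp add: vec_eq_iff)
  have "norm (?D F (vec_upd x i (x $ i)) - ?D F (vec_upd x i (d $ i))) \<le> ?C * norm (x $ i - d $ i)"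
  proof (rule field_differentiable_bound[where S = "{a $ i..b $ i}"])
    fix t assume t: "t \<in> {a $ i..b $ i}"
    show "((\<lambda>t. ?D F (vec_upd x i t)) has_real_derivative
        ?D (partial_deriv a b i F) (vec_upd x i t)) (at t within {a $ i..b $ i})"
      using fold_diff_at_has_real_derivative[OF F assms(3) i in_box[OF t]] by (simp add: upd2)
    have "\<bar>?D (partial_deriv a b i F) (vec_upd x i t)\<bar>
        \<le> M * (\<Prod>k\<in>set is. \<bar>vec_upd x i t $ k - d $ k\<bar>)"
      using snoc.prems F' by (intro snoc.IH in_box t) (auto simp: iter_partial_snoc)
    \<comment> \<open>Since \<open>i\<close> is not in \<open>is\<close>, the product does not
      change with \<open>t\<close>, so the derivative bound is uniform on the segment.\<close>
    also have "(\<Prod>k\<in>set is. \<bar>vec_upd x i t $ k - d $ k\<bar>) = (\<Prod>k\<in>set is. \<bar>x $ k - d $ k\<bar>)"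
      using i by (intro prod.cong) auto
    finally show "norm (?D (partial_deriv a b i F) (vec_upd x i t)) \<le> ?C"
      by simp
  qed (use snoc.prems assms(3) in \<open>auto simp: mem_box_cart\<close>)
  then show ?case
    using i by (simp add: diff_at_def[of d i] algebra_simps)
qed

text \<open>Once \<open>F\<close> is replaced by its mixed difference, the integrand is bounded
  pointwise by a constant times a product of univariate functions, and the integral of that product
  factors.\<close>

lemma abs_integral_prod_le_lborel:
  fixes w :: "'n::finite \<Rightarrow> real \<Rightarrow> real"
  assumes w: "\<And>i. integrable lborel (w i)" "\<And>i t. t \<notin> {l $ i..h $ i} \<Longrightarrow> w i t = 0"
    and lh: "\<And>i. a $ i \<le> l $ i" "\<And>i. l $ i \<le> h $ i" "\<And>i. h $ i \<le> b $ i"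
    and F: "continuous_on (cbox a b) F"
    and "distinct is" "has_iter_partial a b is F"
    and M: "\<And>y. y \<in> cbox a b \<Longrightarrow> \<bar>iter_partial a b is F y\<bar> \<le> M"
    and w0: "\<And>i. i \<in> set is \<Longrightarrow> (LINT t|lborel. w i t) = 0"
  shows "\<bar>LINT x|lborel. F x * (\<Prod>i\<in>UNIV. w i (x $ i))\<bar>
    \<le> M * (\<Prod>i\<in>set is. (h $ i - l $ i) / 2) * (\<Prod>i\<in>UNIV. (LINT t|lborel. \<bar>w i t\<bar>))"
proof -
  \<comment> \<open>The midpoint keeps every distance to \<open>d\<close> on \<open>[l, h]\<close>
    below half the side length, which is the source of the factor one half in
    \<open>haar_lambda\<close>.\<close>
  define d where "d = (\<chi> i. (l $ i + h $ i) / 2)"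
  have dc: "a $ i \<le> d $ i" "d $ i \<le> b $ i" for i
    using lh[of i] by (simp_all add: d_def)
  then have d: "d \<in> cbox a b"
    by (simp add: mem_box_cart)
  have w': "w i t = 0" if "t \<notin> {a $ i..b $ i}" for i t
    using that lh[of i] by (intro w(2)) auto
  let ?D = "fold (diff_at d) is F"
  have M0: "0 \<le> M"
    using M[OF d] by linarith
  have "(LINT x|lborel. F x * (\<Prod>i\<in>UNIV. w i (x $ i)))
      = (LINT x|lborel. ?D x * (\<Prod>i\<in>UNIV. w i (x $ i)))"
    using integral_fold_diff_at[OF w(1) w' d F w0] by simp
  also have "\<bar>\<dots>\<bar> \<le> (LINT x|lborel. M * (\<Prod>i\<in>set is. (h $ i - l $ i) / 2) * (\<Prod>i\<in>UNIV. \<bar>w i (x $ i)\<bar>))"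
  proof (rule integral_abs_bound_integral)
    show "integrable lborel (\<lambda>x. ?D x * (\<Prod>i\<in>UNIV. w i (x $ i)))"
      using w(1) w' F d by (intro integrable_continuous_on_cbox_prod continuous_on_fold_diff_at) auto
    show "integrable lborel (\<lambda>x. M * (\<Prod>i\<in>set is. (h $ i - l $ i) / 2) * (\<Prod>i\<in>UNIV. \<bar>w i (x $ i)\<bar>))"
      using w(1) by (intro integrable_mult_right integrable_lborel_vec_prod) auto
    fix x :: "real ^ 'n"
    show "\<bar>?D x * (\<Prod>i\<in>UNIV. w i (x $ i))\<bar>
      \<le> M * (\<Prod>i\<in>set is. (h $ i - l $ i) / 2) * (\<Prod>i\<in>UNIV. \<bar>w i (x $ i)\<bar>)"
    proof (cases "x \<in> cbox l h")
      case True
      then have x: "l $ i \<le> x $ i" "x $ i \<le> h $ i" for i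
        by (auto simp: mem_box_cart)
      have xc: "a $ i \<le> x $ i" "x $ i \<le> b $ i" for i
        using x[of i] lh[of i] by linarith+
      have "\<bar>?D x\<bar> \<le> M * (\<Prod>i\<in>set is. \<bar>x $ i - d $ i\<bar>)"
        using assms xc dc by (intro abs_fold_diff_at_le) (auto simp: mem_box_cart)
      also have "\<dots> \<le> M * (\<Prod>i\<in>set is. (h $ i - l $ i) / 2)"
      proof (intro mult_left_mono[OF _ M0] prod_mono conjI)
        fix i
        show "\<bar>x $ i - d $ i\<bar> \<le> (h $ i - l $ i) / 2"
          using x[of i] by (auto simp: d_def abs_le_iff field_simps)
      qed auto
      finally show ?thesis
        by (simp add: abs_mult abs_prod mult_right_mono prod_nonneg)
    next
      case False
      then obtain i where "x $ i \<notin> {l $ i..h $ i}"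
        by (auto simp: mem_box_cart)
      then have "w i (x $ i) = 0"
        by (rule w(2))
      then have "(\<Prod>i\<in>UNIV. w i (x $ i)) = 0"
        by (intro prod_zero) auto
      moreover have "0 \<le> M * (\<Prod>i\<in>set is. (h $ i - l $ i) / 2) * (\<Prod>i\<in>UNIV. \<bar>w i (x $ i)\<bar>)"
        using lh(2) M0 by (intro mult_nonneg_nonneg prod_nonneg) auto
      ultimately show ?thesis
        by (simp only: mult_zero_right abs_zero)
    qed
  qed
  also have "\<dots> = M * (\<Prod>i\<in>set is. (h $ i - l $ i) / 2) * (\<Prod>i\<in>UNIV. (LINT t|lborel. \<bar>w i t\<bar>))"
    using w(1) by (subst integral_mult_right_zero, subst integral_lborel_vec_prod) auto
  finally show ?thesis .
qed

lemma abs_integral_prod_le: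
  fixes w :: "'n::finite \<Rightarrow> real \<Rightarrow> real"
  assumes w: "\<And>i. integrable lebesgue (w i)" "\<And>i t. t \<notin> {l $ i..h $ i} \<Longrightarrow> w i t = 0"
    and lh: "\<And>i. a $ i \<le> l $ i" "\<And>i. l $ i \<le> h $ i" "\<And>i. h $ i \<le> b $ i"
    and F: "continuous_on (cbox a b) F"
    and "distinct is" "has_iter_partial a b is F"
    and M: "\<And>y. y \<in> cbox a b \<Longrightarrow> \<bar>iter_partial a b is F y\<bar> \<le> M"
    and w0: "\<And>i. i \<in> set is \<Longrightarrow> (LINT t|lebesgue. w i t) = 0"
  shows "\<bar>LINT x|lebesgue_on (cbox a b). F x * (\<Prod>i\<in>UNIV. w i (x $ i))\<bar>
    \<le> M * (\<Prod>i\<in>set is. (h $ i - l $ i) / 2) * (\<Prod>i\<in>UNIV. (LINT t|lebesgue. \<bar>w i t\<bar>))"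
proof -
  \<comment> \<open>The product of the \<open>w i\<close> is measurable only for the completion of the product measure,
    where Fubini is not available, so they are first replaced by Borel functions.\<close>
  have "\<exists>g \<in> borel_measurable lborel. AE t in lborel. w i t = g t" for i
    using w(1)[of i] by (intro completion_ex_borel_measurable_real) auto
  then obtain g where g: "\<And>i. g i \<in> borel_measurable lborel" "\<And>i. AE t in lborel. w i t = g i t"
    by metis
  \<comment> \<open>The Borel version \<open>g i\<close> may be nonzero on a null set outside the
    support; the indicator restores the support condition everywhere.\<close>
  define v where "v i t = indicator {l $ i..h $ i} t * g i t" for i t
  have [measurable]: "v i \<in> borel_measurable borel" for i
    using g(1)[of i] unfolding v_def by measurable
  have ae: "AE t in lborel. w i t = v i t" for i
    using g(2)[of i] by eventually_elim (use w(2)[where i = i] in \<open>force simp: v_def indicator_def\<close>)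
  have ae': "AE t in lebesgue. w i t = v i t" for i
    using ae by (rule AE_completion)
  have wm: "w i \<in> borel_measurable lebesgue" for i
    using w(1) by auto
  have vm: "v i \<in> borel_measurable lebesgue" for i
    by (intro measurable_completion) auto
  have v: "integrable lborel (v i)" for i
  proof -
    have "integrable lebesgue (v i)"
      using w(1)[of i] integrable_cong_AE[OF wm vm ae'] by simp
    then show ?thesis
      by (simp add: integrable_completion)
  qed
  have v_int: "(LINT t|lborel. v i t) = (LINT t|lebesgue. w i t)" for i
    using integral_cong_AE[OF wm vm ae'] by (simp add: integral_completion)
  have v_abs: "(LINT t|lborel. \<bar>v i t\<bar>) = (LINT t|lebesgue. \<bar>w i t\<bar>)" for i
  proof -
    have "(LINT t|lebesgue. \<bar>w i t\<bar>) = (LINT t|lebesgue. \<bar>v i t\<bar>)"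
      using ae'[of i] wm vm by (intro integral_cong_AE) auto
    then show ?thesis
      by (simp add: integral_completion)
  qed
  have v_supp: "v i t = 0" if "t \<notin> {l $ i..h $ i}" for i t
    using that by (simp add: v_def)
  let ?V = "\<lambda>x. F x * (\<Prod>i\<in>UNIV. v i (x $ i))"
  have V: "integrable lborel ?V"
  proof (rule integrable_continuous_on_cbox_prod[OF F v])
    show "v i t = 0" if "t \<notin> {a $ i..b $ i}" for i t
      using that lh[of i] by (intro v_supp) auto
  qed
  have "(LINT x|lebesgue_on (cbox a b). F x * (\<Prod>i\<in>UNIV. w i (x $ i)))
      = (LINT x|lebesgue. indicator (cbox a b) x *\<^sub>R (F x * (\<Prod>i\<in>UNIV. w i (x $ i))))"
    by (intro integral_restrict_space) auto
  also have "\<dots> = (LINT x|lebesgue. F x * (\<Prod>i\<in>UNIV. w i (x $ i)))"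
  proof (intro Bochner_Integration.integral_cong refl)
    fix x
    have "(\<Prod>i\<in>UNIV. w i (x $ i)) = 0" if x: "x \<notin> cbox a b"
    proof -
      from x obtain i where "x $ i \<notin> {a $ i..b $ i}"
        by (auto simp: mem_box_cart)
      then have "w i (x $ i) = 0"
        using lh[of i] by (intro w(2)) auto
      then show ?thesis
        by (auto intro!: prod_zero)
    qed
    then show "indicator (cbox a b) x *\<^sub>R (F x * (\<Prod>i\<in>UNIV. w i (x $ i)))
        = F x * (\<Prod>i\<in>UNIV. w i (x $ i))"
      by (auto simp: indicator_def)
  qed
  also have "\<dots> = (LINT x|lebesgue. ?V x)"
  proof -
    have "AE x in lborel. \<forall>i. w i (x $ i) = v i (x $ i)"
      using AE_lborel_vec_nth[OF ae] by (intro AE_all_countable[THEN iffD2] allI) auto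
    then have "AE x in lborel. F x * (\<Prod>i\<in>UNIV. w i (x $ i)) = ?V x"
      by eventually_elim simp
    then have eq: "AE x in lebesgue. F x * (\<Prod>i\<in>UNIV. w i (x $ i)) = ?V x"
      by (rule AE_completion)
    have Vm: "?V \<in> borel_measurable lebesgue"
      using V by (intro measurable_completion) auto
    \<comment> \<open>By completeness of Lebesgue measure, measurability passes from
      \<open>?V\<close> to the integrand that equals it almost everywhere.\<close>
    moreover have "(\<lambda>x. F x * (\<Prod>i\<in>UNIV. w i (x $ i))) \<in> borel_measurable lebesgue"
      by (rule borel_measurable_AE[OF Vm]) (use eq in \<open>eventually_elim, simp only:\<close>)
    ultimately show ?thesis
      using eq by (intro integral_cong_AE) auto
  qed
  also have "\<dots> = (LINT x|lborel. ?V x)"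
    using V by (intro integral_completion) auto
  also have "\<bar>\<dots>\<bar> \<le> M * (\<Prod>i\<in>set is. (h $ i - l $ i) / 2) * (\<Prod>i\<in>UNIV. (LINT t|lborel. \<bar>v i t\<bar>))"
    using assms v v_supp v_int by (intro abs_integral_prod_le_lborel) auto
  finally show ?thesis
    by (simp only: v_abs)
qed

subsection \<open>Densities and univariate Haar functions\<close>

context
  fixes c d :: real and f :: "real \<Rightarrow> real"
  assumes dens: "prob_density_on c d f"
    and bij: "bij_betw (cdf_on c f) {c..d} {0..1}"
begin

lemma integrable_indicator_density:
  assumes "S \<in> sets lebesgue" "S \<subseteq> {c..d}"
  shows "integrable lebesgue (\<lambda>t. indicator S t * f t)"
proof -
  have "integrable (lebesgue_on {c..d}) f"
    using dens by (auto simp: prob_density_on_def has_bochner_integral_iff)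
  then have "integrable lebesgue (\<lambda>t. indicator {c..d} t * f t)"
    by (simp add: integrable_restrict_space)
  then have "integrable lebesgue (\<lambda>t. indicator S t *\<^sub>R (indicator {c..d} t * f t))"
    using assms(1) by (intro integrable_mult_indicator) auto
  moreover have "(\<lambda>t. indicator S t *\<^sub>R (indicator {c..d} t * f t)) = (\<lambda>t. indicator S t * f t)"
  proof
    fix t
    show "indicator S t *\<^sub>R (indicator {c..d} t * f t) = indicator S t * f t"
      using assms(2) by (cases "t \<in> S") auto
  qed
  ultimately show ?thesis
    by (simp only:)
qed

text \<open>Half-open intervals are used because these are the pieces on which a Haar function is
  constant.\<close>

lemma integral_indicator_density:
  assumes "c \<le> x" "x \<le> y" "y \<le> d"
  shows "(LINT t|lebesgue. indicator {x..<y} t * f t) = cdf_on c f y - cdf_on c f x"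
proof -
  have cdf: "cdf_on c f z = (LINT t|lebesgue. indicator {c..z} t * f t)" for z
    by (simp add: cdf_on_def integral_restrict_space)
  have i: "integrable lebesgue (\<lambda>t. indicator {c..z} t * f t)" if "z \<le> d" for z
    using that by (intro integrable_indicator_density) auto
  have i': "integrable lebesgue (\<lambda>t. indicator {x..<y} t * f t)"
    using assms by (intro integrable_indicator_density) auto
  \<comment> \<open>The difference of \<open>{c..y}\<close> and \<open>{c..x}\<close> is open on the
    left and closed on the right, so it agrees with \<open>{x..<y}\<close> up to the two
    endpoints.\<close>
  have "AE t in lborel. t \<noteq> x" "AE t in lborel. t \<noteq> y"
    by (rule AE_lborel_singleton)+
  then have "AE t in lborel. indicator {x..<y} t * f t
      = indicator {c..y} t * f t - indicator {c..x} t * f t"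
    by eventually_elim (use assms in \<open>auto simp: indicator_def\<close>)
  then have "(LINT t|lebesgue. indicator {x..<y} t * f t)
      = (LINT t|lebesgue. indicator {c..y} t * f t - indicator {c..x} t * f t)"
    using i[of x] i[of y] i' assms by (intro integral_cong_AE AE_completion) auto
  also have "\<dots> = cdf_on c f y - cdf_on c f x"
    unfolding cdf using assms i by (intro Bochner_Integration.integral_diff) auto
  finally show ?thesis .
qed

text \<open>A nonnegative density gives monotonicity; strictness comes from injectivity of the
  distribution function, as the density itself may vanish at points.\<close>

lemma cdf_on_less_iff:
  assumes "x \<in> {c..d}" "y \<in> {c..d}"
  shows "cdf_on c f x < cdf_on c f y \<longleftrightarrow> x < y"
proof -
  have mono: "cdf_on c f x \<le> cdf_on c f y" if "c \<le> x" "x \<le> y" "y \<le> d" for x y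
  proof -
    have "0 \<le> (LINT t|lebesgue. indicator {x..<y} t * f t)"
      using dens that by (intro Bochner_Integration.integral_nonneg)
        (auto simp: prob_density_on_def indicator_def)
    then show ?thesis
      using integral_indicator_density[OF that] by simp
  qed
  have "x = y" if "cdf_on c f x = cdf_on c f y"
    using bij assms that by (auto simp: bij_betw_def inj_on_def)
  then show ?thesis
    using mono[of x y] mono[of y x] assms by (smt (verit) atLeastAtMost_iff)
qed

lemma inv_cdf_on:
  assumes "y \<in> {0..1}"
  shows "inv_cdf_on c d f y \<in> {c..d}" "cdf_on c f (inv_cdf_on c d f y) = y"
proof -
  show "cdf_on c f (inv_cdf_on c d f y) = y"
    unfolding inv_cdf_on_def using bij assms by (intro f_the_inv_into_f_bij_betw) auto
  show "inv_cdf_on c d f y \<in> {c..d}"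
    unfolding inv_cdf_on_def
    using bij assms by (intro the_inv_into_into) (auto simp: bij_betw_def)
qed

lemma inv_cdf_on_le_iff:
  assumes "y \<in> {0..1}" "t \<in> {c..d}"
  shows "y \<le> cdf_on c f t \<longleftrightarrow> inv_cdf_on c d f y \<le> t"
  using cdf_on_less_iff[OF assms(2) inv_cdf_on(1)[OF assms(1)]] inv_cdf_on(2)[OF assms(1)]
  by (metis not_less)

text \<open>With \<open>r\<close> the preimage of the midpoint of the dyadic interval, the weight is
  \<open>2 powr (j / 2)\<close> times \<open>f\<close> on \<open>[p, r)\<close> and minus that on
  \<open>[r, q)\<close>. Both halves carry mass \<open>1 / (2 * 2 ^ j)\<close>, so the integrals
  cancel, while the absolute values add up to \<open>2 powr (j / 2) / 2 ^ j\<close>.\<close>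

lemma
  fixes j m :: nat
  assumes m: "m < 2 ^ j"
  defines "w \<equiv> \<lambda>t. indicator {c..d} t * haar (int j) m (cdf_on c f t) * f t"
    and "p \<equiv> inv_cdf_on c d f (real m / 2 ^ j)"
    and "q \<equiv> inv_cdf_on c d f ((real m + 1) / 2 ^ j)"
  shows haar_support: "c \<le> p" "p \<le> q" "q \<le> d" "\<And>t. t \<notin> {p..q} \<Longrightarrow> w t = 0"
    and integrable_haar: "integrable lebesgue w"
    and integral_haar: "(LINT t|lebesgue. w t) = 0"
    and integral_abs_haar: "(LINT t|lebesgue. \<bar>w t\<bar>) = 1 / 2 powr (real j / 2)"
proof -
  define yp yr yq :: real where
    y_def: "yp = real m / 2 ^ j" "yr = (2 * real m + 1) / 2 ^ (j + 1)" "yq = (real m + 1) / 2 ^ j"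
  define r where "r = inv_cdf_on c d f yr"
  have pq: "p = inv_cdf_on c d f yp" "q = inv_cdf_on c d f yq"
    by (simp_all add: p_def q_def y_def)
  have m': "real m + 1 \<le> 2 ^ j"
    using m by (metis Suc_leI of_nat_Suc of_nat_le_iff of_nat_numeral of_nat_power add.commute)
  have diffs: "yr - yp = 1 / (2 * 2 ^ j)" "yq - yr = 1 / (2 * 2 ^ j)"
    by (simp_all add: y_def field_simps)
  have "0 \<le> yp" "yq \<le> 1"
    using m' by (simp_all add: y_def)
  moreover have "0 < 1 / (2 * 2 ^ j :: real)"
    by simp
  ultimately have y: "yp \<in> {0..1}" "yr \<in> {0..1}" "yq \<in> {0..1}" "yp < yr" "yr < yq"
    using diffs unfolding atLeastAtMost_iff by linarith+
  note in_cd = inv_cdf_on(1)[OF y(1), folded pq] inv_cdf_on(1)[OF y(2), folded r_def]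
    inv_cdf_on(1)[OF y(3), folded pq]
  note cdf = inv_cdf_on(2)[OF y(1), folded pq] inv_cdf_on(2)[OF y(2), folded r_def]
    inv_cdf_on(2)[OF y(3), folded pq]
  have "p < r" "r < q"
    using cdf_on_less_iff[OF in_cd(1,2)] cdf_on_less_iff[OF in_cd(2,3)] y(4,5) by (simp_all add: cdf)
  with in_cd have le: "c \<le> p" "p \<le> r" "r \<le> q" "q \<le> d" "r \<le> d" "c \<le> r"
    by auto
  then show "c \<le> p" "p \<le> q" "q \<le> d"
    by auto
  let ?g = "\<lambda>S t. indicator S t * f t"
  have haar: "haar (int j) m z = (if yp \<le> z \<and> z < yr then 2 powr (real j / 2)
      else if yr \<le> z \<and> z < yq then - (2 powr (real j / 2)) else 0)" for z
    by (simp add: haar_def y_def)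
  \<comment> \<open>By \<open>inv_cdf_on_le_iff\<close>, the thresholds \<open>yp\<close>,
    \<open>yr\<close>, \<open>yq\<close> for the distribution function become the thresholds
    \<open>p\<close>, \<open>r\<close>, \<open>q\<close> for \<open>t\<close>.\<close>
  have w: "w t = 2 powr (real j / 2) * (?g {p..<r} t - ?g {r..<q} t)" for t
  proof (cases "t \<in> {c..d}")
    case True
    show ?thesis
      using inv_cdf_on_le_iff[OF y(1) True] inv_cdf_on_le_iff[OF y(2) True]
        inv_cdf_on_le_iff[OF y(3) True] le True
      by (auto simp: w_def haar indicator_def pq[symmetric] r_def[symmetric])
  next
    case False
    then show ?thesis
      using le by (auto simp: w_def indicator_def)
  qed
  \<comment> \<open>The two pieces are disjoint and the density is nonnegative, so the absolute
    value only turns the minus sign into a plus.\<close>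
  have w_abs: "\<bar>w t\<bar> = 2 powr (real j / 2) * (?g {p..<r} t + ?g {r..<q} t)" for t
    using dens le unfolding w by (auto simp: indicator_def prob_density_on_def abs_mult)
  have int: "integrable lebesgue (?g {p..<r})" "integrable lebesgue (?g {r..<q})"
    using le by (auto intro!: integrable_indicator_density)
  show "w t = 0" if "t \<notin> {p..q}" for t
    using that le unfolding w by (auto simp: indicator_def)
  show "integrable lebesgue w"
    unfolding w using int by (intro integrable_mult_right Bochner_Integration.integrable_diff)
  have eq: "(LINT t|lebesgue. ?g {p..<r} t) = 1 / (2 * 2 ^ j)"
    "(LINT t|lebesgue. ?g {r..<q} t) = 1 / (2 * 2 ^ j)"
    using integral_indicator_density[of p r] integral_indicator_density[of r q] le cdf diffs by simp_all
  show "(LINT t|lebesgue. w t) = 0"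
    unfolding w using int by (simp add: eq)
  have "(LINT t|lebesgue. \<bar>w t\<bar>) = 2 powr (real j / 2) / 2 ^ j"
    unfolding w_abs using int by (simp add: eq)
  also have "(2 :: real) ^ j = 2 powr (real j / 2) * 2 powr (real j / 2)"
    by (simp add: powr_add[symmetric] powr_realpow)
  finally show "(LINT t|lebesgue. \<bar>w t\<bar>) = 1 / 2 powr (real j / 2)"
    by simp
qed

lemma integral_abs_density: "(LINT t|lebesgue. \<bar>indicator {c..d} t * f t\<bar>) = 1"
proof -
  have "\<bar>indicator {c..d} t * f t\<bar> = indicator {c..d} t *\<^sub>R f t" for t
    using dens by (auto simp: prob_density_on_def indicator_def)
  then show ?thesis
    using dens integral_restrict_space[of "{c..d}" lebesgue f]
    by (auto simp: prob_density_on_def has_bochner_integral_iff)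
qed

end

subsection \<open>Regularity from the weighted norm\<close>

text \<open>Existence of partial derivatives alone does not give continuity, but bounds on them make
  \<open>F\<close> Lipschitz: pass from \<open>x\<close> to \<open>y\<close> one coordinate at a
  time and apply the mixed difference bound for a single variable, with \<open>y\<close> as base
  point.\<close>

lemma continuous_on_bounded_partial_derivs:
  fixes F :: "real ^ 'n \<Rightarrow> real"
  assumes F: "\<And>i. has_partial_deriv_on a b i F"
    and M: "\<And>i x. x \<in> cbox a b \<Longrightarrow> \<bar>partial_deriv a b i F x\<bar> \<le> M i"
  shows "continuous_on (cbox a b) F"
proof -
  have step: "\<bar>F x - F (vec_upd x i (y $ i))\<bar> \<le> M i * \<bar>x $ i - y $ i\<bar>"
    if "x \<in> cbox a b" "y \<in> cbox a b" for x y i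
    using abs_fold_diff_at_le[of "[i]" a b F y x "M i"] that F M
    by (simp add: diff_at_def iter_partial_def)
  have chain: "\<bar>F x - F y\<bar> \<le> (\<Sum>i\<in>S. M i * \<bar>x $ i - y $ i\<bar>)"
    if "finite S" "x \<in> cbox a b" "y \<in> cbox a b" "\<And>i. i \<notin> S \<Longrightarrow> x $ i = y $ i" for S x y
    using that
  proof (induction S arbitrary: x rule: finite_induct)
    case empty
    then have "x = y"
      by (simp add: vec_eq_iff)
    then show ?case
      by simp
  next
    case (insert i S)
    let ?z = "vec_upd x i (y $ i)"
    have "\<bar>F ?z - F y\<bar> \<le> (\<Sum>k\<in>S. M k * \<bar>?z $ k - y $ k\<bar>)"
      using insert.prems by (intro insert.IH vec_upd_in_cbox) (auto simp: mem_box_cart)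
    also have "\<dots> = (\<Sum>k\<in>S. M k * \<bar>x $ k - y $ k\<bar>)"
      using insert.hyps by (intro sum.cong) auto
    finally show ?case
      using step[OF insert.prems(1,2), of i] insert.hyps by simp
  qed
  \<comment> \<open>A Lipschitz constant must be nonnegative, and on an empty box the bounds
    \<open>M i\<close> could be negative; hence the absolute values.\<close>
  have "(\<Sum>i\<in>UNIV. \<bar>M i\<bar>)-lipschitz_on (cbox a b) F"
  proof (rule lipschitz_onI)
    fix x y assume xy: "x \<in> cbox a b" "y \<in> cbox a b"
    have "dist (F x) (F y) \<le> (\<Sum>i\<in>UNIV. M i * \<bar>x $ i - y $ i\<bar>)"
      using chain[of UNIV x y] xy by (simp add: dist_real_def)
    also have "\<dots> \<le> (\<Sum>i\<in>UNIV. \<bar>M i\<bar> * dist x y)"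
      using component_le_norm_cart[of "x - y"]
      by (intro sum_mono mult_mono) (auto simp: dist_norm)
    finally show "dist (F x) (F y) \<le> (\<Sum>i\<in>UNIV. \<bar>M i\<bar>) * dist x y"
      by (simp add: sum_distrib_right)
  qed (simp add: sum_nonneg)
  then show ?thesis
    by (rule lipschitz_on_continuous_on)
qed

lemma ennreal_powr_less_top_iff: "ennreal_powr x r < \<infinity> \<longleftrightarrow> x < \<infinity>"
  by (auto simp: ennreal_powr_def less_top[symmetric])

lemma mixed_partial_bounded:
  assumes "weighted_norm a b p \<gamma> F < \<infinity>" "\<gamma> v > 0"
  obtains M where "\<And>x. x \<in> cbox a b \<Longrightarrow> \<bar>mixed_partial a b v F x\<bar> \<le> M"
proof -
  have "weighted_sup a b \<gamma> F v < \<infinity>"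
  proof (cases "p = \<infinity>")
    case True
    then have "(MAX u\<in>UNIV. weighted_sup a b \<gamma> F u) < \<infinity>"
      using assms by (simp add: weighted_norm_def)
    then show ?thesis
      by (subst (asm) Max_less_iff) auto
  next
    case False
    then have "(\<Sum>u\<in>UNIV. ennreal_powr (weighted_sup a b \<gamma> F u) (enn2real p)) < \<infinity>"
      using assms by (simp add: weighted_norm_def ennreal_powr_less_top_iff[simplified])
    then have "ennreal_powr (weighted_sup a b \<gamma> F v) (enn2real p) < \<infinity>"
      by (simp add: less_top[symmetric])
    then show ?thesis
      by (simp only: ennreal_powr_less_top_iff)
  qed
  \<comment> \<open>The factor \<open>1 / \<gamma> v\<close> is nonzero, so finiteness of the
    weighted supremum forces finiteness of the supremum.\<close>
  then have fin: "(SUP x\<in>cbox a b. ennreal \<bar>mixed_partial a b v F x\<bar>) < top" (is "?S < _")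
    using assms(2) unfolding weighted_sup_def by (auto simp: ennreal_mult_less_top)
  show thesis
  proof (rule that)
    fix x assume "x \<in> cbox a b"
    then have "ennreal \<bar>mixed_partial a b v F x\<bar> \<le> ?S"
      by (rule SUP_upper)
    then show "\<bar>mixed_partial a b v F x\<bar> \<le> enn2real ?S"
      using fin by (metis abs_ge_zero enn2real_ennreal enn2real_mono)
  qed
qed

subsection \<open>The coefficient bound\<close>

theorem lemma1:
  fixes a b :: "real ^ 'n::{finite,linorder}"
    and \<phi> :: "'n \<Rightarrow> real \<Rightarrow> real"
    and \<gamma> :: "'n set \<Rightarrow> real"
    and p :: ennreal
    and F :: "real ^ 'n::_ \<Rightarrow> real"
    and u :: "'n set"
    and j m :: "'n \<Rightarrow> nat"
  assumes "\<And>i. a $ i < b $ i"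
    and "\<And>i. prob_density_on (a $ i) (b $ i) (\<phi> i)"
    and "\<And>i. bij_betw (cdf_on (a $ i) (\<phi> i)) {a $ i..b $ i} {0..1}"
    and "\<And>v. \<gamma> v > 0"
    and "1 \<le> p"
    and "has_mixed_partials a b F"
    and "weighted_norm a b p \<gamma> F < \<infinity>"
    and "u \<noteq> {}"
    and "\<And>i. ext_shift u m i \<in> haar_D (ext_level u j i)"
  shows "\<bar>haar_coeff a b \<phi> F (ext_level u j) (ext_shift u m)\<bar>
    \<le> 1 / 2 powr (real (\<Sum>i\<in>u. j i) / 2)
        * (\<Prod>i\<in>u. haar_lambda (a $ i) (b $ i) (\<phi> i) (j i) (m i))
        * (SUP x\<in>cbox a b. \<bar>mixed_partial a b u F x\<bar>)"
proof -
  define us where "us = sorted_list_of_set u"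
  have us: "set us = u" "distinct us"
    by (simp_all add: us_def)
  define w where "w i t = indicator {a $ i..b $ i} t
    * haar (ext_level u j i) (ext_shift u m i) (cdf_on (a $ i) (\<phi> i) t) * \<phi> i t" for i t
  \<comment> \<open>Outside \<open>u\<close> the weight is the density itself, supported on all of
    \<open>[a i, b i]\<close>. Those side lengths do not enter the bound, which only takes the
    product over \<open>u\<close>.\<close>
  define l where "l = (\<chi> i. if i \<in> u then inv_cdf_on (a $ i) (b $ i) (\<phi> i) (real (m i) / 2 ^ j i) else a $ i)"
  define h where "h = (\<chi> i. if i \<in> u then inv_cdf_on (a $ i) (b $ i) (\<phi> i) ((real (m i) + 1) / 2 ^ j i) else b $ i)"
  define M where "M = (SUP x\<in>cbox a b. \<bar>mixed_partial a b u F x\<bar>)"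
  note D = assms(2,3)
  have m: "m i < 2 ^ j i" if "i \<in> u" for i
    using assms(9)[of i] that by (auto simp: haar_D_def ext_level_def ext_shift_def)
  have w_in: "w i = (\<lambda>t. indicator {a $ i..b $ i} t * haar (int (j i)) (m i) (cdf_on (a $ i) (\<phi> i) t) * \<phi> i t)"
    if "i \<in> u" for i
    using that by (auto simp: w_def ext_level_def ext_shift_def)
  have w_out: "w i = (\<lambda>t. indicator {a $ i..b $ i} t * \<phi> i t)" if "i \<notin> u" for i
    using that by (auto simp: w_def ext_level_def haar_def)

  have M: "\<bar>iter_partial a b us F x\<bar> \<le> M" if "x \<in> cbox a b" for x
  proof -
    obtain K where "\<And>x. x \<in> cbox a b \<Longrightarrow> \<bar>mixed_partial a b u F x\<bar> \<le> K"
      using mixed_partial_bounded[OF assms(7,4)] by metis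
    \<comment> \<open>The real-valued supremum in the conclusion is an upper bound only for a
      bounded family; the finite norm ensures this.\<close>
    then have "bdd_above ((\<lambda>x. \<bar>mixed_partial a b u F x\<bar>) ` cbox a b)"
      by (auto simp: bdd_above_def)
    then show ?thesis
      using that unfolding M_def us_def mixed_partial_def[symmetric] by (intro cSUP_upper)
  qed

  have F: "continuous_on (cbox a b) F"
  proof -
    \<comment> \<open>First order derivatives are the mixed ones for singletons, so the norm
      controls them as well.\<close>
    have "\<exists>K. \<forall>x\<in>cbox a b. \<bar>partial_deriv a b i F x\<bar> \<le> K" for i
      by (rule mixed_partial_bounded[OF assms(7,4), of "{i}"])
        (auto simp: mixed_partial_def iter_partial_def)
    then obtain K where "\<And>i x. x \<in> cbox a b \<Longrightarrow> \<bar>partial_deriv a b i F x\<bar> \<le> K i"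
      by metis
    moreover have "has_partial_deriv_on a b i F" for i
      using assms(6)[unfolded has_mixed_partials_def, rule_format, of "{i}"]
      by (simp add: iter_partial_def)
    ultimately show ?thesis
      by (intro continuous_on_bounded_partial_derivs)
  qed

  have "haar_coeff a b \<phi> F (ext_level u j) (ext_shift u m)
      = (LINT x|lebesgue_on (cbox a b). F x * (\<Prod>i\<in>UNIV. w i (x $ i)))"
    unfolding haar_coeff_def
    by (intro Bochner_Integration.integral_cong refl)
      (auto simp: haar_prod_def w_def prod.distrib mem_box_cart)
  also have "\<bar>\<dots>\<bar> \<le> M * (\<Prod>i\<in>set us. (h $ i - l $ i) / 2) * (\<Prod>i\<in>UNIV. (LINT t|lebesgue. \<bar>w i t\<bar>))"
  proof (rule abs_integral_prod_le[OF _ _ _ _ _ F us(2) _ M])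
    fix i
    show "integrable lebesgue (w i)"
      using integrable_haar[OF D m] integrable_indicator_density[OF D]
      by (cases "i \<in> u") (auto simp: w_in w_out)
    show "a $ i \<le> l $ i" "l $ i \<le> h $ i" "h $ i \<le> b $ i"
      using haar_support(1-3)[OF D m] assms(1)[of i]
      by (cases "i \<in> u"; auto simp: l_def h_def)+
    show "w i t = 0" if "t \<notin> {l $ i..h $ i}" for t
    proof (cases "i \<in> u")
      case True
      then show ?thesis
        using haar_support(4)[OF D m[OF True], of t] that by (simp add: w_in l_def h_def)
    qed (use that in \<open>auto simp: w_out l_def h_def indicator_def\<close>)
    show "has_iter_partial a b us F"
      using assms(6) by (simp add: has_mixed_partials_def us_def)
    show "(LINT t|lebesgue. w i t) = 0" if "i \<in> set us"
      using integral_haar[OF D m] that by (simp add: us w_in)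
  qed
  also have "(\<Prod>i\<in>set us. (h $ i - l $ i) / 2)
      = (\<Prod>i\<in>u. haar_lambda (a $ i) (b $ i) (\<phi> i) (j i) (m i))"
    by (intro prod.cong) (auto simp: us haar_lambda_def l_def h_def)
  \<comment> \<open>Coordinates outside \<open>u\<close> contribute the total mass of a density,
    which is one.\<close>
  also have "(\<Prod>i\<in>UNIV. (LINT t|lebesgue. \<bar>w i t\<bar>)) = (\<Prod>i\<in>u. 1 / 2 powr (real (j i) / 2))"
    using integral_abs_haar[OF D m] integral_abs_density[OF D]
    by (intro prod.mono_neutral_cong_right) (auto simp: w_in w_out)
  also have "\<dots> = 1 / 2 powr (real (\<Sum>i\<in>u. j i) / 2)"
    by (simp add: prod_dividef powr_sum[symmetric] sum_divide_distrib)
  finally show ?thesis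
    by (simp add: M_def mult_ac)
qed

end
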